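(* Assume a periodic boundary condition in space. Consider the sub-step $xv$, $\partial_tf=-\boldsymbol v\cdot\nabla_xf$ (with magnetic field and pressure unchanged), solved over one time step by one-dimensional translations in each spatial direction, performed either with the Fourier spectral method or with the cubic spline based semi-Lagrangian method described in the context. Then the scheme conserves mass, momentum and energy exactly: the values of $\mathcal M_h$, $\mathcal P_{h,\alpha}$ ($\alpha=1,2,3$) and $\mathcal E_h$ after the step equal those before the step.
   Context: Space is the periodic box $\prod_{\alpha=1}^3[0,L_\alpha]$ with a uniform grid $\mathbf x_{\boldsymbol i}$ ($M_\alpha$ points and spacing $\Delta x_\alpha=L_\alpha/M_\alpha$ in direction $\alpha$); velocity has a uniform grid $\mathbf v_{\boldsymbol j}=(v^1_{j_1},v^2_{j_2},v^3_{j_3})$ with spacings $\Delta v_\alpha$; $\Delta\boldsymbol x=\prod_\alpha\Delta x_\alpha$, $\Delta\boldsymbol v=\prod_\alpha\Delta v_\alpha$. The unknowns are $f_{\boldsymbol i\boldsymbol j}$, $\mathbf B_{\boldsymbol i}\in\mathbb R^3$, $p_{\boldsymbol i}\in\mathbb R$; $\gamma\ne1$ is a constant. If the velocity grid is infinite, sums of $f_{\boldsymbol i\boldsymbol j}$ weighted by velocity polynomials of degree $\le2$ are assumed absolutely convergent. Discrete invariants: $\mathcal M_h=\sum_{\boldsymbol i\boldsymbol j}f_{\boldsymbol i\boldsymbol j}\Delta\boldsymbol x\Delta\boldsymbol v$, $\ \mathcal P_{h,\alpha}=\sum_{\boldsymbol i\boldsymbol j}v^\alpha_{j_\alpha}f_{\boldsymbol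 i\boldsymbol j}\Delta\boldsymbol x\Delta\boldsymbol v$, $$\mathcal E_h=\frac12\sum_{\boldsymbol i\boldsymbol j}|\mathbf v_{\boldsymbol j}|^2f_{\boldsymbol i\boldsymbol j}\Delta\boldsymbol x\Delta\boldsymbol v+\frac12\sum_{\boldsymbol i}|\mathbf B_{\boldsymbol i}|^2\Delta\boldsymbol x+\frac1{\gamma-1}\sum_{\boldsymbol i}p_{\boldsymbol i}\Delta\boldsymbol x .$$ The sub-step with step size $\Delta t$: for $\alpha=1,2,3$ successively, for each velocity index $\boldsymbol j$ and along each spatial grid line in direction $\alpha$, the periodic one-dimensional equation $\partial_tf+c\,\partial_zf=0$ with $c=v^\alpha_{j_\alpha}$ is advanced by $\Delta t$. On a periodic uniform grid $z_1,\dots,z_N$ with spacing $\Delta z$ and period $L=N\Delta z$, this is done by one of: Fourier spectral method: $\mathbf f^{n+1}=\mathcal F_z^{-1}e^{-\mathrm ic\Delta t\beta}\mathcal F_z\mathbf f^n$, where $\mathcal F_z$ is the discrete Fourier transform $\hat f(\beta)=\sum_{i}f_ie^{-\mathrm iz_i\beta}$, $\beta\in\frac{2\pi}L\{-\lfloor\frac{N-1}2\rfloor,\dots,\lfloor\frac N2\rfloor\}$, and $e^{-\mathrm ic\Delta t\beta}$ acts by multiplication. Cubic spline semi-Lagrangian method: $f_i^{n+1}=\mathcal If^n(z_i-c\Delta t)$, where $\mathcal If^n(z)=\sum_je_jC(z-z_j)$ (with $C$ extended periodically) is the periodic cubic spline with $\mathcal If^n(z_i)=f_i^n$, and $C(z)=\frac16(2-|z|/\Delta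 z)^3$ if $\Delta z\le|z|<2\Delta z$, $C(z)=\frac16(4-6(|z|/\Delta z)^2+3(|z|/\Delta z)^3)$ if $|z|<\Delta z$, $C(z)=0$ otherwise. *)

theory Defs
  imports "HOL-Analysis.Analysis"
begin

section \<open>Translation on a periodic one-dimensional grid\<close>

text \<open>
  A one-dimensional grid is given by the number \<open>N\<close> of its points, its first point \<open>a\<close> and its
  spacing \<open>h\<close>; the points are numbered \<open>1, \<dots>, N\<close> and the period is \<open>N * h\<close>.
  Grid functions are complex-valued: for even \<open>N\<close> the mode \<open>\<lfloor>N/2\<rfloor>\<close> has no conjugate partner among
  the frequencies used, so that the Fourier method can turn real data into complex data.
\<close>

definition node :: "real \<Rightarrow> real \<Rightarrow> nat \<Rightarrow> real" where
  "node a h i = a + (real i - 1) * h"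

definition mode_set :: "nat \<Rightarrow> int set" where
  "mode_set N = {- \<lfloor>(real N - 1) / 2\<rfloor> .. \<lfloor>real N / 2\<rfloor>}"

definition freq :: "nat \<Rightarrow> real \<Rightarrow> int \<Rightarrow> real" where
  "freq N h k = 2 * pi / (real N * h) * of_int k"

definition dft :: "nat \<Rightarrow> real \<Rightarrow> real \<Rightarrow> (nat \<Rightarrow> complex) \<Rightarrow> int \<Rightarrow> complex" where
  "dft N a h f k = (\<Sum>i=1..N. f i * exp (- \<i> * of_real (node a h i * freq N h k)))"

definition idft :: "nat \<Rightarrow> real \<Rightarrow> real \<Rightarrow> (int \<Rightarrow> complex) \<Rightarrow> nat \<Rightarrow> complex" where
  "idft N a h F i =
     (\<Sum>k\<in>mode_set N. F k * exp (\<i> * of_real (node a h i * freq N h k))) / of_nat N"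

definition fourier_translate ::
    "nat \<Rightarrow> real \<Rightarrow> real \<Rightarrow> real \<Rightarrow> real \<Rightarrow> (nat \<Rightarrow> complex) \<Rightarrow> nat \<Rightarrow> complex" where
  "fourier_translate N a h c dt f =
     idft N a h (\<lambda>k. exp (- \<i> * of_real (c * dt * freq N h k)) * dft N a h f k)"

definition cubic_bspline :: "real \<Rightarrow> real \<Rightarrow> real" where
  "cubic_bspline h z =
     (if h \<le> \<bar>z\<bar> \<and> \<bar>z\<bar> < 2 * h then 1 / 6 * (2 - \<bar>z\<bar> / h) ^ 3
      else if \<bar>z\<bar> < h then 1 / 6 * (4 - 6 * (\<bar>z\<bar> / h) ^ 2 + 3 * (\<bar>z\<bar> / h) ^ 3)
      else 0)"

text \<open>
  The periodic extension is the sum of all translates by multiples of the period. Only finitely many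
  terms are nonzero. For \<open>N \<ge> 4\<close> the supports do not overlap, for \<open>N < 4\<close> the translates have to be
  added up for the result to be a periodic spline.
\<close>

definition periodic_bspline :: "nat \<Rightarrow> real \<Rightarrow> real \<Rightarrow> real" where
  "periodic_bspline N h z = (\<Sum>\<^sub>\<infinity>k\<in>(UNIV::int set). cubic_bspline h (z - of_int k * (real N * h)))"

definition spline_eval :: "nat \<Rightarrow> real \<Rightarrow> real \<Rightarrow> (nat \<Rightarrow> complex) \<Rightarrow> real \<Rightarrow> complex" where
  "spline_eval N a h e z = (\<Sum>j=1..N. e j * of_real (periodic_bspline N h (z - node a h j)))"

text \<open>The coefficients outside \<open>{1..N}\<close> play no role; they are set to zero to make \<open>e\<close> unique.\<close>

definition spline_coeffs :: "nat \<Rightarrow> real \<Rightarrow> real \<Rightarrow> (nat \<Rightarrow> complex) \<Rightarrow> nat \<Rightarrow> complex" where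
  "spline_coeffs N a h f =
     (THE e. (\<forall>j. j \<notin> {1..N} \<longrightarrow> e j = 0) \<and>
             (\<forall>i\<in>{1..N}. spline_eval N a h e (node a h i) = f i))"

definition spline_translate ::
    "nat \<Rightarrow> real \<Rightarrow> real \<Rightarrow> real \<Rightarrow> real \<Rightarrow> (nat \<Rightarrow> complex) \<Rightarrow> nat \<Rightarrow> complex" where
  "spline_translate N a h c dt f i =
     spline_eval N a h (spline_coeffs N a h f) (node a h i - c * dt)"

datatype translation = Fourier_Spectral | Cubic_Spline

fun translate ::
    "translation \<Rightarrow> nat \<Rightarrow> real \<Rightarrow> real \<Rightarrow> real \<Rightarrow> real \<Rightarrow> (nat \<Rightarrow> complex) \<Rightarrow> nat \<Rightarrow> complex" where
  "translate Fourier_Spectral = fourier_translate"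
| "translate Cubic_Spline = spline_translate"


section \<open>Phase space grid\<close>

text \<open>
  Directions are elements of the three-element type \<open>3\<close>. In direction \<open>\<alpha>\<close> the box has length
  \<open>len \<alpha>\<close>, the spatial grid has \<open>num \<alpha>\<close> points starting at \<open>xfst \<alpha>\<close>, and the velocity grid consists
  of the points \<open>voff \<alpha> + k * vspc \<alpha>\<close> with \<open>k\<close> ranging over the finite or infinite set
  \<open>vidx \<alpha>\<close> of consecutive integers.
\<close>

record phase_grid =
  len :: "3 \<Rightarrow> real"
  num :: "3 \<Rightarrow> nat"
  xfst :: "3 \<Rightarrow> real"
  vidx :: "3 \<Rightarrow> int set"
  voff :: "3 \<Rightarrow> real"
  vspc :: "3 \<Rightarrow> real"

definition xspc :: "phase_grid \<Rightarrow> 3 \<Rightarrow> real" where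
  "xspc G \<alpha> = len G \<alpha> / real (num G \<alpha>)"

definition valid_grid :: "phase_grid \<Rightarrow> bool" where
  "valid_grid G \<longleftrightarrow>
     (\<forall>\<alpha>. len G \<alpha> > 0 \<and> num G \<alpha> \<ge> 1 \<and>
          (\<forall>i\<in>{1..num G \<alpha>}. node (xfst G \<alpha>) (xspc G \<alpha>) i \<in> {0..len G \<alpha>}) \<and>
          vspc G \<alpha> > 0 \<and> vidx G \<alpha> \<noteq> {} \<and>
          (\<forall>k\<in>vidx G \<alpha>. \<forall>l\<in>vidx G \<alpha>. {k..l} \<subseteq> vidx G \<alpha>))"

definition xind :: "phase_grid \<Rightarrow> (3 \<Rightarrow> nat) set" where
  "xind G = {i. \<forall>\<alpha>. i \<alpha> \<in> {1..num G \<alpha>}}"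

definition vind :: "phase_grid \<Rightarrow> (3 \<Rightarrow> int) set" where
  "vind G = {j. \<forall>\<alpha>. j \<alpha> \<in> vidx G \<alpha>}"

definition vel :: "phase_grid \<Rightarrow> (3 \<Rightarrow> int) \<Rightarrow> real ^ 3" where
  "vel G j = (\<chi> \<alpha>. voff G \<alpha> + of_int (j \<alpha>) * vspc G \<alpha>)"

definition dx :: "phase_grid \<Rightarrow> real" where
  "dx G = (\<Prod>\<alpha>\<in>UNIV. xspc G \<alpha>)"

definition dv :: "phase_grid \<Rightarrow> real" where
  "dv G = (\<Prod>\<alpha>\<in>UNIV. vspc G \<alpha>)"


section \<open>The sub-step and the discrete invariants\<close>

text \<open>A state consists of the particle distribution, the magnetic field and the pressure.\<close>

type_synonym distr = "(3 \<Rightarrow> nat) \<Rightarrow> (3 \<Rightarrow> int) \<Rightarrow> complex"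
type_synonym state = "distr \<times> ((3 \<Rightarrow> nat) \<Rightarrow> real ^ 3) \<times> ((3 \<Rightarrow> nat) \<Rightarrow> real)"

definition directional_step :: "translation \<Rightarrow> phase_grid \<Rightarrow> real \<Rightarrow> 3 \<Rightarrow> distr \<Rightarrow> distr" where
  "directional_step m G dt \<alpha> f = (\<lambda>i j.
     translate m (num G \<alpha>) (xfst G \<alpha>) (xspc G \<alpha>) (vel G j $ \<alpha>) dt (\<lambda>k. f (i(\<alpha> := k)) j) (i \<alpha>))"

fun xv_step :: "translation \<Rightarrow> phase_grid \<Rightarrow> real \<Rightarrow> state \<Rightarrow> state" where
  "xv_step m G dt (f, B, p) =
     (directional_step m G dt 3 (directional_step m G dt 2 (directional_step m G dt 1 f)), B, p)"

text \<open>
  Absolute convergence of the sums of \<open>f\<close> weighted by velocity polynomials of degree at most two,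
  expressed for the monomials with exponents \<open>q\<close>.
\<close>

fun moments_summable :: "phase_grid \<Rightarrow> state \<Rightarrow> bool" where
  "moments_summable G (f, B, p) \<longleftrightarrow>
     (\<forall>q :: 3 \<Rightarrow> nat. (\<Sum>\<alpha>\<in>UNIV. q \<alpha>) \<le> 2 \<longrightarrow>
        (\<lambda>(i, j). norm (of_real (\<Prod>\<alpha>\<in>UNIV. (vel G j $ \<alpha>) ^ q \<alpha>) * f i j))
          summable_on (xind G \<times> vind G))"

fun mass :: "phase_grid \<Rightarrow> state \<Rightarrow> complex" where
  "mass G (f, B, p) =
     (\<Sum>\<^sub>\<infinity>(i, j)\<in>xind G \<times> vind G. f i j * of_real (dx G) * of_real (dv G))"

fun momentum :: "phase_grid \<Rightarrow> 3 \<Rightarrow> state \<Rightarrow> complex" where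
  "momentum G \<alpha> (f, B, p) =
     (\<Sum>\<^sub>\<infinity>(i, j)\<in>xind G \<times> vind G.
        of_real (vel G j $ \<alpha>) * f i j * of_real (dx G) * of_real (dv G))"

fun energy :: "phase_grid \<Rightarrow> real \<Rightarrow> state \<Rightarrow> complex" where
  "energy G \<gamma> (f, B, p) =
     1 / 2 * (\<Sum>\<^sub>\<infinity>(i, j)\<in>xind G \<times> vind G.
                of_real ((norm (vel G j))\<^sup>2) * f i j * of_real (dx G) * of_real (dv G))
     + of_real (1 / 2 * (\<Sum>i\<in>xind G. (norm (B i))\<^sup>2 * dx G)
                + 1 / (\<gamma> - 1) * (\<Sum>i\<in>xind G. p i * dx G))"

end

theory Submission
  imports Defs
begin

text \<open>
  A translation in one spatial direction changes \<open>f\<close> only along grid lines of fixed velocity, so a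
  sum weighted by any function \<open>W\<close> of the velocity alone is conserved as soon as the sum of \<open>f\<close> along
  each periodic grid line is. Mass, momentum and kinetic energy are the cases of weight \<open>1\<close>,
  \<open>v\<^sub>\<alpha>\<close> and \<open>\<bar>v\<bar>\<^sup>2\<close>; the magnetic and the internal energy do not change.

  In the Fourier method the sum along a line is the zeroth Fourier coefficient, whose multiplier
  is \<open>1\<close> (\<open>fourier_translate_sum\<close>). In the spline method the B-splines form a partition of unity:
  their values on any shifted copy of the grid add up to \<open>1\<close>, so the sum of the interpolant over the
  shifted grid is the sum of the spline coefficients, whatever the shift
  (\<open>spline_eval_sum\<close>). The shift zero gives the sum of the data, the shift \<open>c * dt\<close> that of
  the translated values (\<open>spline_translate_sum\<close>). This presupposes that the periodic interpolation
  problem has exactly one solution (\<open>spline_coeffs_interpolate\<close>): its matrix has nonnegative entries,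
  column sums \<open>1\<close> and a diagonal of at least \<open>2/3\<close>, so it differs from the identity by at most
  \<open>2/3\<close> in the column-sum norm and a Neumann series inverts it.

  On an infinite velocity grid the weighted sums also have to remain absolutely convergent. For
  this, both methods are shown to enlarge the sum of absolute values along a line by at most
  a factor that depends neither on the speed nor on the data (\<open>translate_norm_bound\<close>). With the finite
  spatial sum performed first, absolute convergence follows by comparison, and
  the conservation along lines carries over to the infinite sums (\<open>directional_step_moment\<close>).
\<close>

\<comment> \<open>Keeps the summation range \<open>{1..N}\<close> in the form used by the rewrite rules below.\<close>
declare One_nat_def [simp del]

section \<open>Matrices close to the identity in the column-sum norm\<close>

lemma column_sum_bound:
  fixes D :: "'a \<Rightarrow> 'a \<Rightarrow> complex" and e :: "'a \<Rightarrow> complex"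
  assumes "\<And>j. j \<in> I \<Longrightarrow> (\<Sum>i\<in>I. norm (D i j)) \<le> q"
  shows "(\<Sum>i\<in>I. norm (\<Sum>j\<in>I. e j * D i j)) \<le> q * (\<Sum>j\<in>I. norm (e j))"
proof -
  have "(\<Sum>i\<in>I. norm (\<Sum>j\<in>I. e j * D i j)) \<le> (\<Sum>i\<in>I. \<Sum>j\<in>I. norm (e j) * norm (D i j))"
    by (intro sum_mono order_trans[OF norm_sum] sum_mono) (simp add: norm_mult)
  also have "\<dots> = (\<Sum>j\<in>I. norm (e j) * (\<Sum>i\<in>I. norm (D i j)))"
    by (subst sum.swap) (simp add: sum_distrib_left)
  also have "\<dots> \<le> (\<Sum>j\<in>I. norm (e j) * q)"
    by (intro sum_mono mult_left_mono assms) auto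
  finally show ?thesis
    by (simp add: sum_distrib_left mult.commute)
qed

text \<open>
  Write \<open>e = A e + (1 - A) e\<close> and apply the triangle inequality. For \<open>q < 1\<close> this gives both
  uniqueness of solutions of \<open>A e = f\<close> and a bound on \<open>e\<close> by \<open>f\<close>.
\<close>

lemma near_identity_lower_bound:
  fixes A :: "'a \<Rightarrow> 'a \<Rightarrow> complex" and e :: "'a \<Rightarrow> complex"
  assumes "finite I"
    and col: "\<And>j. j \<in> I \<Longrightarrow> (\<Sum>i\<in>I. norm ((if i = j then 1 else 0) - A i j)) \<le> q"
  shows "(1 - q) * (\<Sum>j\<in>I. norm (e j)) \<le> (\<Sum>i\<in>I. norm (\<Sum>j\<in>I. e j * A i j))"
proof -
  define D where "D = (\<lambda>i j. (if i = j then 1 else 0) - A i j)"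
  have split: "e i = (\<Sum>j\<in>I. e j * A i j) + (\<Sum>j\<in>I. e j * D i j)" if "i \<in> I" for i
  proof -
    have "(\<Sum>j\<in>I. e j * A i j) + (\<Sum>j\<in>I. e j * D i j) = (\<Sum>j\<in>I. if i = j then e j else 0)"
      unfolding sum.distrib[symmetric] by (intro sum.cong) (auto simp: D_def algebra_simps)
    then show ?thesis
      using that \<open>finite I\<close> by simp
  qed
  have "(\<Sum>i\<in>I. norm (e i)) \<le>
      (\<Sum>i\<in>I. norm (\<Sum>j\<in>I. e j * A i j) + norm (\<Sum>j\<in>I. e j * D i j))"
    by (intro sum_mono) (subst split, simp, rule norm_triangle_ineq)
  also have "\<dots> \<le> (\<Sum>i\<in>I. norm (\<Sum>j\<in>I. e j * A i j)) + q * (\<Sum>j\<in>I. norm (e j))"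
    using column_sum_bound[of I D q e] col by (simp add: sum.distrib D_def)
  finally show ?thesis
    by (simp add: algebra_simps)
qed

text \<open>
  The Neumann series: with \<open>A = 1 - D\<close> the solution of \<open>A e = f\<close> is the sum of the iterates \<open>D\<^sup>n f\<close>,
  which decay geometrically because \<open>D\<close> contracts the sum of the absolute values.
\<close>

lemma near_identity_solvable:
  fixes A :: "'a \<Rightarrow> 'a \<Rightarrow> complex" and f :: "'a \<Rightarrow> complex"
  assumes "finite I" and q: "0 \<le> q" "q < 1"
    and col: "\<And>j. j \<in> I \<Longrightarrow> (\<Sum>i\<in>I. norm ((if i = j then 1 else 0) - A i j)) \<le> q"
  shows "\<exists>e. \<forall>i\<in>I. (\<Sum>j\<in>I. e j * A i j) = f i"
proof -
  define D where "D = (\<lambda>i j. (if i = j then 1 else 0) - A i j)"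
  define u where "u = rec_nat f (\<lambda>_ g i. \<Sum>j\<in>I. g j * D i j)"
  have u_Suc: "u (Suc n) i = (\<Sum>j\<in>I. u n j * D i j)" for n i
    by (simp add: u_def)
  have decay: "(\<Sum>i\<in>I. norm (u n i)) \<le> q ^ n * (\<Sum>i\<in>I. norm (f i))" for n
  proof (induction n)
    case 0
    then show ?case by (simp add: u_def)
  next
    case (Suc n)
    have "(\<Sum>i\<in>I. norm (u (Suc n) i)) \<le> q * (\<Sum>j\<in>I. norm (u n j))"
      unfolding u_Suc by (rule column_sum_bound) (use col in \<open>simp add: D_def\<close>)
    also have "\<dots> \<le> q * (q ^ n * (\<Sum>i\<in>I. norm (f i)))"
      by (rule mult_left_mono) (use Suc q in auto)
    finally show ?case by (simp add: mult.assoc)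
  qed
  have summ: "summable (\<lambda>n. u n i)" if "i \<in> I" for i
  proof (rule summable_comparison_test')
    show "summable (\<lambda>n. q ^ n * (\<Sum>i\<in>I. norm (f i)))"
      using q by (intro summable_mult2 summable_geometric) auto
    fix n :: nat
    have "norm (u n i) \<le> (\<Sum>i\<in>I. norm (u n i))"
      by (rule member_le_sum) (use that \<open>finite I\<close> in auto)
    then show "norm (u n i) \<le> q ^ n * (\<Sum>i\<in>I. norm (f i))"
      using decay[of n] by linarith
  qed
  define e where "e = (\<lambda>i. \<Sum>n. u n i)"
  have "(\<Sum>j\<in>I. e j * A i j) = f i" if i: "i \<in> I" for i
  proof -
    have "(\<Sum>j\<in>I. e j * D i j) = (\<Sum>n. u (Suc n) i)"
      unfolding u_Suc e_def using summ
      by (subst suminf_sum) (auto intro!: sum.cong summable_mult2 suminf_mult2)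
    also have "\<dots> = e i - f i"
      using suminf_split_head[OF summ[OF i]] by (simp add: e_def u_def)
    finally have D: "(\<Sum>j\<in>I. e j * D i j) = e i - f i" .
    have "(\<Sum>j\<in>I. e j * A i j) = (\<Sum>j\<in>I. (if i = j then e j else 0) - e j * D i j)"
      by (intro sum.cong) (auto simp: D_def algebra_simps)
    also have "\<dots> = e i - (e i - f i)"
      using i \<open>finite I\<close> D by (simp add: sum_subtractf)
    finally show ?thesis by simp
  qed
  then show ?thesis by blast
qed

section \<open>The cubic spline translation\<close>

lemma cubic_bspline_nonneg: "cubic_bspline h z \<ge> 0"
proof (cases "\<bar>z\<bar> < h")
  case True
  define t where "t = \<bar>z\<bar> / h"
  have t: "0 \<le> t" "t < 1"
    using True by (auto simp: t_def)
  \<comment> \<open>\<open>4 - 6 t\<^sup>2 + 3 t\<^sup>3 = 3 (t\<^sup>3 - 2 t\<^sup>2 + 1) + 1\<close>, and the cubic in brackets has the root \<open>1\<close>.\<close>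
  have "t^2 \<le> 1"
    using t by (simp add: power_le_one)
  moreover have "0 \<le> t^3"
    using t by simp
  moreover have "t^3 - 2 * t^2 + 1 = (1 - t) * (1 + t - t^2)"
    by (simp add: algebra_simps power2_eq_square power3_eq_cube)
  moreover have "0 \<le> (1 - t) * (1 + t - t^2)"
    using t \<open>t^2 \<le> 1\<close> by (intro mult_nonneg_nonneg) auto
  ultimately have "0 \<le> 4 - 6 * t^2 + 3 * t^3"
    by linarith
  then show ?thesis
    using True by (simp add: cubic_bspline_def t_def)
next
  case False
  then show ?thesis
    by (auto simp: cubic_bspline_def divide_le_eq)
qed

lemma cubic_bspline_scaled:
  assumes "h > 0"
  shows "cubic_bspline h (h * u) = cubic_bspline 1 u"
proof -
  have "\<bar>h * u\<bar> = h * \<bar>u\<bar>"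
    using assms by (simp add: abs_mult)
  then show ?thesis
    using assms by (simp add: cubic_bspline_def mult.commute[of 2])
qed

text \<open>
  Only four integer translates of the B-spline are nonzero at a given point; with \<open>t\<close> the
  fractional part of the point their values are the four cubics in \<open>t\<close> below.
\<close>

lemma cubic_bspline_partition_of_unity:
  assumes h: "h > 0"
  shows "((\<lambda>n. cubic_bspline h (y + of_int n * h)) has_sum 1) (UNIV :: int set)"
proof -
  define t where "t = frac (y / h)"
  define m where "m = - \<lfloor>y / h\<rfloor>"
  have t: "0 \<le> t" "t < 1"
    by (auto simp: t_def frac_ge_0 frac_lt_1)
  have *: "cubic_bspline h (y + of_int n * h) = cubic_bspline 1 (t + of_int (n - m))" for n
  proof -
    have "y + of_int n * h = h * (t + of_int (n - m))"
      using h by (simp add: t_def m_def frac_def field_simps)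
    then show ?thesis
      using cubic_bspline_scaled[OF h] by simp
  qed
  let ?S = "{m - 2, m - 1, m, m + 1}"
  have zero: "cubic_bspline h (y + of_int n * h) = 0" if "n \<notin> ?S" for n
  proof -
    have "n - m \<le> -3 \<or> n - m \<ge> 2"
      using that by auto
    then have "2 \<le> \<bar>t + of_int (n - m)\<bar>"
      using t by linarith
    then show ?thesis
      unfolding * by (simp add: cubic_bspline_def)
  qed
  have "(\<Sum>n\<in>?S. cubic_bspline h (y + of_int n * h)) =
     cubic_bspline 1 (t - 2) + cubic_bspline 1 (t - 1) + cubic_bspline 1 t + cubic_bspline 1 (t + 1)"
    unfolding * by (simp add: algebra_simps)
  also have "\<dots> = t^3 / 6 + (4 - 6 * (1 - t)^2 + 3 * (1 - t)^3) / 6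
      + (4 - 6 * t^2 + 3 * t^3) / 6 + (1 - t)^3 / 6"
  proof -
    have "cubic_bspline 1 (t - 2) = t^3 / 6"
      using t by (auto simp: cubic_bspline_def)
    moreover have "cubic_bspline 1 (t - 1) = (4 - 6 * (1 - t)^2 + 3 * (1 - t)^3) / 6"
      using t by (cases "t = 0") (auto simp: cubic_bspline_def)
    moreover have "cubic_bspline 1 t = (4 - 6 * t^2 + 3 * t^3) / 6"
      using t by (auto simp: cubic_bspline_def)
    moreover have "cubic_bspline 1 (t + 1) = (1 - t)^3 / 6"
      using t by (auto simp: cubic_bspline_def)
    ultimately show ?thesis by (simp only:)
  qed
  also have "\<dots> = 1"
    by (simp add: field_simps power2_eq_square power3_eq_cube)
  finally have sum1: "(\<Sum>n\<in>?S. cubic_bspline h (y + of_int n * h)) = 1" .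
  have "((\<lambda>n. cubic_bspline h (y + of_int n * h)) has_sum 1) ?S"
    using has_sum_finite[of ?S "\<lambda>n. cubic_bspline h (y + of_int n * h)"] unfolding sum1 by simp
  then show ?thesis
    by (rule has_sum_cong_neutral[THEN iffD1, rotated -1]) (use zero in auto)
qed

lemma periodic_bspline_summable:
  assumes "h > 0" "N \<ge> 1"
  shows "(\<lambda>k. cubic_bspline h (z - of_int k * (real N * h))) summable_on (UNIV :: int set)"
proof -
  have "(\<lambda>n. cubic_bspline h (z + of_int n * h)) summable_on range (\<lambda>k :: int. - k * int N)"
    by (rule summable_on_subset_banach[OF has_sum_imp_summable])
      (rule cubic_bspline_partition_of_unity[OF assms(1)], simp)
  then have "((\<lambda>n. cubic_bspline h (z + of_int n * h)) \<circ> (\<lambda>k :: int. - k * int N)) summable_on UNIV"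
    by (subst (asm) summable_on_reindex) (use assms in \<open>auto simp: inj_on_def\<close>)
  then show ?thesis
    by (simp add: o_def mult.assoc)
qed

lemma periodic_bspline_nonneg: "periodic_bspline N h z \<ge> 0"
  unfolding periodic_bspline_def by (intro infsum_nonneg cubic_bspline_nonneg)

lemma periodic_bspline_0:
  assumes "h > 0" "N \<ge> 1"
  shows "periodic_bspline N h 0 \<ge> 2 / 3"
proof -
  have "(\<Sum>k\<in>{0 :: int}. cubic_bspline h (0 - of_int k * (real N * h))) \<le> periodic_bspline N h 0"
    unfolding periodic_bspline_def
    by (rule finite_sum_le_infsum) (use periodic_bspline_summable[OF assms, of 0] cubic_bspline_nonneg in auto)
  then show ?thesis
    using assms by (simp add: cubic_bspline_def)
qed

text \<open>
  Division with remainder by \<open>N\<close> merges the translates by multiples of the period, which make up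
  the periodic extension, with the shifts along the grid into all integer shifts, so that the
  partition of unity applies.
\<close>

lemma periodic_bspline_sum:
  assumes "h > 0" "N \<ge> 1"
  shows "(\<Sum>i=1..N. periodic_bspline N h (y + real i * h)) = 1"
proof -
  let ?g = "\<lambda>n :: int. cubic_bspline h (y + of_int n * h)"
  let ?\<phi> = "\<lambda>(i :: nat, k :: int). int i - k * int N"
  have bij: "bij_betw ?\<phi> ({1..N} \<times> UNIV) UNIV"
    \<comment> \<open>The points are numbered from \<open>1\<close>, so the remainder of \<open>n - 1\<close> decides on the point.\<close>
  proof (rule bij_betwI[where g = "\<lambda>n. (nat ((n - 1) mod int N) + 1, - ((n - 1) div int N))"])
    show "(\<lambda>n. (nat ((n - 1) mod int N) + 1, - ((n - 1) div int N))) \<in> UNIV \<rightarrow> {1..N} \<times> UNIV"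
    proof
      fix n :: int
      have "0 \<le> (n - 1) mod int N" "(n - 1) mod int N < int N"
        using assms(2) by auto
      then have "nat ((n - 1) mod int N) < N"
        by linarith
      then show "(nat ((n - 1) mod int N) + 1, - ((n - 1) div int N)) \<in> {1..N} \<times> UNIV"
        by auto
    qed
  next
    fix x assume "x \<in> {1..N} \<times> (UNIV :: int set)"
    then obtain i k where x: "x = (i, k)" and i: "i \<in> {1..N}" by auto
    have range: "0 \<le> int i - 1" "int i - 1 < int N"
      using i by auto
    have eq: "int i - k * int N - 1 = (int i - 1) + (- k) * int N"
      by simp
    have "(int i - k * int N - 1) div int N = - k"
      unfolding eq by (subst div_mult_self1) (use range in auto)
    moreover have "(int i - k * int N - 1) mod int N = int i - 1"
      unfolding eq mod_mult_self1 using range by simp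
    ultimately show "(nat ((?\<phi> x - 1) mod int N) + 1, - ((?\<phi> x - 1) div int N)) = x"
      using i by (auto simp: x nat_diff_distrib)
  next
    fix n :: int
    have "int (nat ((n - 1) mod int N)) = (n - 1) mod int N"
      using assms(2) by simp
    moreover have "(n - 1) div int N * int N + (n - 1) mod int N = n - 1"
      by (rule div_mult_mod_eq)
    ultimately show "?\<phi> (nat ((n - 1) mod int N) + 1, - ((n - 1) div int N)) = n"
      unfolding prod.case of_nat_add by linarith
  qed auto
  have "((\<lambda>x. ?g (?\<phi> x)) has_sum 1) ({1..N} \<times> UNIV)"
    by (subst has_sum_reindex_bij_betw[OF bij]) (rule cubic_bspline_partition_of_unity[OF assms(1)])
  then have *: "((\<lambda>(i, k). ?g (int i - k * int N)) has_sum 1) ({1..N} \<times> UNIV)"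
    by (simp add: case_prod_unfold)
  have "1 = (\<Sum>\<^sub>\<infinity>i\<in>{1..N}. \<Sum>\<^sub>\<infinity>k. ?g (int i - k * int N))"
    using infsum_Sigma'_banach[OF has_sum_imp_summable[OF *]] infsumI[OF *] by simp
  also have "\<dots> = (\<Sum>i=1..N. periodic_bspline N h (y + real i * h))"
    by (simp add: periodic_bspline_def algebra_simps)
  finally show ?thesis by simp
qed

text \<open>
  The shift \<open>s\<close> covers the interpolation conditions (\<open>s = 0\<close>) and the translation
  (\<open>s = c * dt\<close>) at the same time.
\<close>

lemma spline_column_sum:
  assumes "h > 0" "N \<ge> 1"
  shows "(\<Sum>i=1..N. periodic_bspline N h (node a h i - s - node a h j)) = 1"
  using periodic_bspline_sum[OF assms, of "- s - real j * h"]
  by (simp add: node_def algebra_simps)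

lemma spline_eval_sum:
  assumes "h > 0" "N \<ge> 1"
  shows "(\<Sum>i=1..N. spline_eval N a h e (node a h i - s)) = (\<Sum>j=1..N. e j)"
proof -
  have "(\<Sum>i=1..N. spline_eval N a h e (node a h i - s)) =
      (\<Sum>j=1..N. e j * of_real (\<Sum>i=1..N. periodic_bspline N h (node a h i - s - node a h j)))"
    unfolding spline_eval_def by (subst sum.swap) (simp only: sum_distrib_left of_real_sum)
  then show ?thesis
    by (simp only: spline_column_sum[OF assms] of_real_1 mult_1_right)
qed

lemma spline_eval_norm_bound:
  assumes "h > 0" "N \<ge> 1"
  shows "(\<Sum>i=1..N. norm (spline_eval N a h e (node a h i - s))) \<le> (\<Sum>j=1..N. norm (e j))"
proof -
  have "(\<Sum>i=1..N. norm (spline_eval N a h e (node a h i - s))) \<le> 1 * (\<Sum>j=1..N. norm (e j))"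
    unfolding spline_eval_def
    by (rule column_sum_bound)
      (simp add: periodic_bspline_nonneg spline_column_sum[OF assms])
  then show ?thesis by simp
qed

text \<open>
  A column of the interpolation matrix is nonnegative, has sum \<open>1\<close> and a diagonal entry of at least
  \<open>2/3\<close>, which leaves at most \<open>1/3\<close> off the diagonal.
\<close>

lemma spline_matrix_near_identity:
  assumes "h > 0" "N \<ge> 1" "j \<in> {1..N}"
  shows "(\<Sum>i=1..N. norm ((if i = j then 1 else 0)
      - complex_of_real (periodic_bspline N h (node a h i - node a h j)))) \<le> 2 / 3"
proof -
  let ?P = "\<lambda>i. periodic_bspline N h (node a h i - node a h j)"
  have P0: "?P j \<ge> 2 / 3"
    using periodic_bspline_0[OF assms(1,2)] by simp
  have split: "(\<Sum>i=1..N. g i) = g j + (\<Sum>i\<in>{1..N} - {j}. g i)" for g :: "nat \<Rightarrow> real"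
    using assms(3) by (simp add: sum.remove)
  have one: "?P j + (\<Sum>i\<in>{1..N} - {j}. ?P i) = 1"
    using spline_column_sum[OF assms(1,2), of a 0 j] split[of ?P] by simp
  have "0 \<le> (\<Sum>i\<in>{1..N} - {j}. ?P i)"
    by (intro sum_nonneg periodic_bspline_nonneg)
  then have "?P j \<le> 1"
    using one by linarith
  have "(\<Sum>i=1..N. norm ((if i = j then 1 else 0) - complex_of_real (?P i)))
      = norm (1 - complex_of_real (?P j)) + (\<Sum>i\<in>{1..N} - {j}. ?P i)"
    unfolding split by (auto intro!: sum.cong simp: periodic_bspline_nonneg)
  also have "norm (1 - complex_of_real (?P j)) = 1 - ?P j"
    using \<open>?P j \<le> 1\<close> by (metis abs_of_nonneg diff_ge_0_iff_ge norm_of_real of_real_1 of_real_diff)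
  finally show ?thesis
    using one P0 by linarith
qed

lemma spline_coeffs_norm_bound:
  assumes "h > 0" "N \<ge> 1"
  shows "(\<Sum>j=1..N. norm (e j)) \<le> 3 * (\<Sum>i=1..N. norm (spline_eval N a h e (node a h i)))"
proof -
  have "(1 - 2 / 3) * (\<Sum>j=1..N. norm (e j)) \<le> (\<Sum>i=1..N. norm (spline_eval N a h e (node a h i)))"
    unfolding spline_eval_def
    by (rule near_identity_lower_bound) (simp, rule spline_matrix_near_identity[OF assms])
  then show ?thesis by simp
qed

lemma spline_coeffs_interpolate:
  assumes h: "h > 0" and N: "N \<ge> 1" and i: "i \<in> {1..N}"
  shows "spline_eval N a h (spline_coeffs N a h f) (node a h i) = f i"
proof -
  let ?Q = "\<lambda>e. (\<forall>j. j \<notin> {1..N} \<longrightarrow> e j = 0) \<and> (\<forall>i\<in>{1..N}. spline_eval N a h e (node a h i) = f i)"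
  obtain e0 where e0: "\<forall>i\<in>{1..N}. (\<Sum>j=1..N. e0 j *
      complex_of_real (periodic_bspline N h (node a h i - node a h j))) = f i"
    using near_identity_solvable[where I = "{1..N}" and q = "2 / 3" and f = f
        and A = "\<lambda>i j. complex_of_real (periodic_bspline N h (node a h i - node a h j))"]
      spline_matrix_near_identity[OF h N, where a = a]
    by auto
  define e where "e = (\<lambda>j. if j \<in> {1..N} then e0 j else 0)"
  have ex: "?Q e"
    using e0 by (auto simp: e_def spline_eval_def)
  have uniq: "e' = e" if e': "?Q e'" for e'
  proof
    fix j
    have "spline_eval N a h (\<lambda>j. e' j - e j) (node a h i) = 0" if "i \<in> {1..N}" for i
    proof -
      have "spline_eval N a h (\<lambda>j. e' j - e j) (node a h i) =
          spline_eval N a h e' (node a h i) - spline_eval N a h e (node a h i)"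
        by (simp add: spline_eval_def left_diff_distrib sum_subtractf)
      then show ?thesis using ex e' that by simp
    qed
    then have "(\<Sum>j=1..N. norm (e' j - e j)) \<le> 0"
      using spline_coeffs_norm_bound[OF h N, where a = a and e = "\<lambda>j. e' j - e j"] by simp
    moreover have "norm (e' j - e j) \<le> (\<Sum>j=1..N. norm (e' j - e j))" if "j \<in> {1..N}"
      using that by (intro member_le_sum) auto
    ultimately have "norm (e' j - e j) \<le> 0" if "j \<in> {1..N}"
      using that by (meson order_trans)
    then show "e' j = e j"
      using ex e' by (cases "j \<in> {1..N}") simp_all
  qed
  have "?Q (spline_coeffs N a h f)"
    unfolding spline_coeffs_def by (rule theI[where a = e]) (use ex uniq in blast)+
  then show ?thesis using i by blast
qed

text \<open>Both sums equal the sum of the spline coefficients.\<close>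

lemma spline_translate_sum:
  assumes "h > 0" "N \<ge> 1"
  shows "(\<Sum>i=1..N. spline_translate N a h c dt f i) = (\<Sum>i=1..N. f i)"
proof -
  have "(\<Sum>i=1..N. spline_translate N a h c dt f i) = (\<Sum>j=1..N. spline_coeffs N a h f j)"
    unfolding spline_translate_def by (rule spline_eval_sum[OF assms])
  also have "\<dots> = (\<Sum>i=1..N. spline_eval N a h (spline_coeffs N a h f) (node a h i))"
    using spline_eval_sum[OF assms, where a = a and e = "spline_coeffs N a h f" and s = 0] by simp
  also have "\<dots> = (\<Sum>i=1..N. f i)"
    by (intro sum.cong refl spline_coeffs_interpolate assms)
  finally show ?thesis .
qed

lemma spline_translate_norm_bound:
  assumes "h > 0" "N \<ge> 1"
  shows "(\<Sum>i=1..N. norm (spline_translate N a h c dt f i)) \<le> 3 * (\<Sum>i=1..N. norm (f i))"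
proof -
  have "(\<Sum>i=1..N. norm (spline_translate N a h c dt f i)) \<le> (\<Sum>j=1..N. norm (spline_coeffs N a h f j))"
    unfolding spline_translate_def by (rule spline_eval_norm_bound[OF assms])
  also have "\<dots> \<le> 3 * (\<Sum>i=1..N. norm (spline_eval N a h (spline_coeffs N a h f) (node a h i)))"
    by (rule spline_coeffs_norm_bound[OF assms])
  also have "\<dots> = 3 * (\<Sum>i=1..N. norm (f i))"
    by (simp add: spline_coeffs_interpolate[OF assms])
  finally show ?thesis .
qed

section \<open>The Fourier spectral translation\<close>

lemma norm_exp_imaginary [simp]:
  "norm (exp (\<i> * complex_of_real x)) = 1" "norm (exp (- (\<i> * complex_of_real x))) = 1"
  by simp_all

text \<open>
  Along the grid a mode is a geometric progression whose ratio is an \<open>N\<close>-th root of unity; for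
  \<open>0 < \<bar>k\<bar> < N\<close> this root is not \<open>1\<close>.
\<close>

lemma mode_grid_sum:
  assumes h: "h > 0" and N: "N \<ge> 1" and k: "\<bar>k\<bar> < int N"
  shows "(\<Sum>i=1..N. exp (\<i> * complex_of_real (node a h i * freq N h k))) = (if k = 0 then of_nat N else 0)"
proof (cases "k = 0")
  case True
  then show ?thesis by (simp add: freq_def)
next
  case False
  define w where "w = cis (2 * pi * of_int k / real N)"
  have "exp (\<i> * complex_of_real (node a h (Suc i) * freq N h k)) = cis (a * freq N h k) * w ^ i" for i
  proof -
    have "node a h (Suc i) * freq N h k = a * freq N h k + real i * (2 * pi * of_int k / real N)"
      using h N by (simp add: node_def freq_def field_simps)
    then have "exp (\<i> * complex_of_real (node a h (Suc i) * freq N h k))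
        = cis (a * freq N h k + real i * (2 * pi * of_int k / real N))"
      by (simp only: cis_conv_exp)
    also have "\<dots> = cis (a * freq N h k) * w ^ i"
      unfolding w_def by (subst Complex.DeMoivre) (rule cis_mult[symmetric])
    finally show ?thesis .
  qed
  then have "(\<Sum>i=1..N. exp (\<i> * complex_of_real (node a h i * freq N h k)))
      = cis (a * freq N h k) * (\<Sum>i<N. w ^ i)"
    by (simp only: sum.atLeast1_atMost_eq One_nat_def sum_distrib_left)
  moreover have "w ^ N = 1"
  proof -
    have "real N * (2 * pi * of_int k / real N) = 2 * pi * of_int k"
      using N by simp
    then show ?thesis
      unfolding w_def Complex.DeMoivre by (metis Ints_of_int cis_multiple_2pi)
  qed
  moreover have "w \<noteq> 1"
  proof
    assume "w = 1"
    then have "cos (2 * pi * of_int k / real N) = 1"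
      by (simp add: w_def complex_eq_iff)
    then obtain m :: int where "2 * pi * of_int k / real N = of_int m * 2 * pi"
      using cos_one_2pi_int by blast
    then have "real_of_int k = of_int m * real N"
      using N by (simp add: field_simps)
    then have "k = m * int N"
      by (metis of_int_eq_iff of_int_mult of_int_of_nat_eq)
    then have "int N dvd k" by simp
    then show False
      using k False zdvd_imp_le[of "int N" "\<bar>k\<bar>"] by auto
  qed
  ultimately show ?thesis
    using False by (simp add: geometric_sum)
qed

lemma mode_set_bound:
  assumes "N \<ge> 1" "k \<in> mode_set N"
  shows "\<bar>k\<bar> < int N"
proof -
  have "- k \<le> \<lfloor>(real N - 1) / 2\<rfloor>" "k \<le> \<lfloor>real N / 2\<rfloor>"
    using assms(2) by (auto simp: mode_set_def)
  then have "- real_of_int k \<le> (real N - 1) / 2" "real_of_int k \<le> real N / 2"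
    by (simp_all add: le_floor_iff)
  moreover have "1 \<le> real N"
    using assms(1) by simp
  ultimately have "real_of_int k < real N" "- real_of_int k < real N"
    by auto
  then show ?thesis by linarith
qed

lemma mode_set_finite: "finite (mode_set N)"
  by (simp add: mode_set_def)

lemma zero_in_mode_set: "N \<ge> 1 \<Longrightarrow> 0 \<in> mode_set N"
  by (simp add: mode_set_def)

text \<open>All modes except the constant one sum to zero over the grid.\<close>

lemma idft_sum:
  assumes h: "h > 0" and N: "N \<ge> 1"
  shows "(\<Sum>i=1..N. idft N a h F i) = F 0"
proof -
  have "(\<Sum>i=1..N. idft N a h F i) = (\<Sum>k\<in>mode_set N. F k *
      (\<Sum>i=1..N. exp (\<i> * of_real (node a h i * freq N h k)))) / of_nat N"
    unfolding idft_def sum_divide_distrib[symmetric] by (subst sum.swap) (simp add: sum_distrib_left)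
  also have "\<dots> = (\<Sum>k\<in>mode_set N. F k * (if k = 0 then of_nat N else 0)) / of_nat N"
    using mode_grid_sum[OF h N mode_set_bound[OF N]] by simp
  also have "\<dots> = (\<Sum>k\<in>mode_set N. if k = 0 then F k * of_nat N else 0) / of_nat N"
    by (simp add: if_distrib cong: if_cong)
  also have "\<dots> = F 0"
    using N zero_in_mode_set[OF N] mode_set_finite by simp
  finally show ?thesis .
qed

lemma fourier_translate_sum:
  assumes "h > 0" "N \<ge> 1"
  shows "(\<Sum>i=1..N. fourier_translate N a h c dt f i) = (\<Sum>i=1..N. f i)"
  unfolding fourier_translate_def idft_sum[OF assms] by (simp add: dft_def freq_def)

lemma fourier_translate_norm_bound:
  assumes "N \<ge> 1"
  shows "(\<Sum>i=1..N. norm (fourier_translate N a h c dt f i))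
    \<le> real (card (mode_set N)) * (\<Sum>i=1..N. norm (f i))"
proof -
  have dft: "norm (dft N a h f k) \<le> (\<Sum>i=1..N. norm (f i))" for k
    unfolding dft_def by (rule order_trans[OF norm_sum]) (simp add: norm_mult)
  have "norm (fourier_translate N a h c dt f i)
      \<le> real (card (mode_set N)) * (\<Sum>i=1..N. norm (f i)) / real N" for i
  proof -
    have "norm (\<Sum>k\<in>mode_set N. exp (- \<i> * of_real (c * dt * freq N h k)) * dft N a h f k
        * exp (\<i> * of_real (node a h i * freq N h k))) \<le> (\<Sum>k\<in>mode_set N. norm (dft N a h f k))"
      by (rule order_trans[OF norm_sum]) (simp add: norm_mult)
    also have "\<dots> \<le> real (card (mode_set N)) * (\<Sum>i=1..N. norm (f i))"
      using dft by (intro sum_bounded_above) auto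
    finally show ?thesis
      unfolding fourier_translate_def idft_def norm_divide by (simp add: divide_right_mono)
  qed
  then have "(\<Sum>i=1..N. norm (fourier_translate N a h c dt f i))
      \<le> (\<Sum>i=1..N. real (card (mode_set N)) * (\<Sum>i=1..N. norm (f i)) / real N)"
    by (intro sum_mono)
  then show ?thesis using assms by simp
qed

section \<open>Conservation along grid lines and in phase space\<close>

lemma translate_sum:
  assumes "h > 0" "N \<ge> 1"
  shows "(\<Sum>i=1..N. translate m N a h c dt f i) = (\<Sum>i=1..N. f i)"
  by (cases m)
    (simp_all only: translate.simps fourier_translate_sum[OF assms] spline_translate_sum[OF assms])

text \<open>
  The constant has to be uniform in the speed \<open>c\<close>, which is unbounded on an infinite velocity grid.
\<close>

lemma translate_norm_bound:
  assumes "h > 0" "N \<ge> 1"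
  shows "\<exists>K. \<forall>c f. (\<Sum>i=1..N. norm (translate m N a h c dt f i)) \<le> K * (\<Sum>i=1..N. norm (f i))"
  using fourier_translate_norm_bound[OF assms(2)] spline_translate_norm_bound[OF assms]
  by (cases m) (simp_all, blast+)

text \<open>
  The spatial grid is the disjoint union of its lines in direction \<open>\<alpha>\<close>. A line is represented by the
  coordinates \<open>b\<close> of its points in the other directions; \<open>b\<close> is undefined at \<open>\<alpha>\<close>.
\<close>

lemma sum_xind_lines:
  fixes g :: "(3 \<Rightarrow> nat) \<Rightarrow> 'a :: comm_monoid_add"
  shows "(\<Sum>i\<in>xind G. g i) =
    (\<Sum>b\<in>Pi\<^sub>E (UNIV - {\<alpha>}) (\<lambda>\<beta>. {1..num G \<beta>}). \<Sum>k=1..num G \<alpha>. g (b(\<alpha> := k)))"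
proof -
  let ?T = "\<lambda>\<beta>. {1..num G \<beta>}"
  have "xind G = Pi\<^sub>E (insert \<alpha> (UNIV - {\<alpha>})) ?T"
    by (auto simp: xind_def PiE_def insert_absorb)
  also have "\<dots> = (\<lambda>(y, g). g(\<alpha> := y)) ` (?T \<alpha> \<times> Pi\<^sub>E (UNIV - {\<alpha>}) ?T)"
    by (rule PiE_insert_eq)
  finally have "(\<Sum>i\<in>xind G. g i) = (\<Sum>(k, b)\<in>?T \<alpha> \<times> Pi\<^sub>E (UNIV - {\<alpha>}) ?T. g (b(\<alpha> := k)))"
    using inj_combinator[of \<alpha> "UNIV - {\<alpha>}" ?T]
    by (simp add: sum.reindex o_def case_prod_unfold)
  also have "\<dots> = (\<Sum>k=1..num G \<alpha>. \<Sum>b\<in>Pi\<^sub>E (UNIV - {\<alpha>}) ?T. g (b(\<alpha> := k)))"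
    by (simp add: sum.cartesian_product)
  finally show ?thesis by (subst sum.swap)
qed

lemma finite_xind: "finite (xind G)"
proof -
  have "xind G = Pi\<^sub>E UNIV (\<lambda>\<beta>. {1..num G \<beta>})"
    by (auto simp: xind_def PiE_def)
  then show ?thesis by (simp add: finite_PiE)
qed

lemma valid_gridD:
  assumes "valid_grid G"
  shows "xspc G \<alpha> > 0" "num G \<alpha> \<ge> 1"
proof -
  have "len G \<alpha> > 0" "num G \<alpha> \<ge> 1"
    using assms unfolding valid_grid_def by blast+
  then show "xspc G \<alpha> > 0" "num G \<alpha> \<ge> 1"
    by (simp_all add: xspc_def)
qed

lemma directional_step_sum:
  assumes "valid_grid G"
  shows "(\<Sum>i\<in>xind G. directional_step m G dt \<alpha> f i j) = (\<Sum>i\<in>xind G. f i j)"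
  unfolding sum_xind_lines[of _ G \<alpha>] directional_step_def
  by (simp only: fun_upd_upd fun_upd_same translate_sum[OF valid_gridD[OF assms]])

lemma directional_step_norm_bound:
  assumes "valid_grid G"
  shows "\<exists>K. \<forall>f j. (\<Sum>i\<in>xind G. norm (directional_step m G dt \<alpha> f i j)) \<le> K * (\<Sum>i\<in>xind G. norm (f i j))"
proof -
  obtain K where K: "(\<Sum>i=1..num G \<alpha>. norm (translate m (num G \<alpha>) (xfst G \<alpha>) (xspc G \<alpha>) c dt f i))
      \<le> K * (\<Sum>i=1..num G \<alpha>. norm (f i))" for c f
    using translate_norm_bound[OF valid_gridD[OF assms]] by meson
  have "(\<Sum>i\<in>xind G. norm (directional_step m G dt \<alpha> f i j)) \<le> K * (\<Sum>i\<in>xind G. norm (f i j))" for f j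
    unfolding sum_xind_lines[of _ G \<alpha>] directional_step_def fun_upd_upd fun_upd_same
    by (subst sum_distrib_left) (intro sum_mono K)
  then show ?thesis by blast
qed

definition weighted_summable :: "phase_grid \<Rightarrow> ((3 \<Rightarrow> int) \<Rightarrow> real) \<Rightarrow> distr \<Rightarrow> bool" where
  "weighted_summable G W f \<longleftrightarrow> (\<lambda>(i, j). norm (of_real (W j) * f i j)) summable_on (xind G \<times> vind G)"

definition moment :: "phase_grid \<Rightarrow> ((3 \<Rightarrow> int) \<Rightarrow> real) \<Rightarrow> distr \<Rightarrow> complex" where
  "moment G W f = (\<Sum>\<^sub>\<infinity>(i, j)\<in>xind G \<times> vind G. of_real (W j) * f i j)"

text \<open>
  The spatial grid is finite, so absolute convergence concerns only the sum over the velocities. In this form the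
  estimates for sums over the spatial grid at a fixed velocity can be applied.
\<close>

lemma weighted_summable_alt:
  "weighted_summable G W f \<longleftrightarrow>
    (\<lambda>j. \<bar>W j\<bar> * (\<Sum>i\<in>xind G. norm (f i j))) summable_on vind G"
proof
  assume "weighted_summable G W f"
  then have "(\<lambda>(j, i). norm (of_real (W j) * f i j)) summable_on (vind G \<times> xind G)"
    unfolding weighted_summable_def by (subst (asm) summable_on_swap) (simp only: prod.case)
  then have "(\<lambda>j. \<Sum>\<^sub>\<infinity>i\<in>xind G. norm (of_real (W j) * f i j)) summable_on vind G"
    by (rule summable_on_Sigma_banach)
  then show "(\<lambda>j. \<bar>W j\<bar> * (\<Sum>i\<in>xind G. norm (f i j))) summable_on vind G"
    by (simp add: finite_xind norm_mult sum_distrib_left)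
next
  assume *: "(\<lambda>j. \<bar>W j\<bar> * (\<Sum>i\<in>xind G. norm (f i j))) summable_on vind G"
  have "(\<lambda>j. norm (of_real (W j) * f i j)) summable_on vind G" if "i \<in> xind G" for i
  proof (rule summable_on_comparison_test[OF *])
    fix j
    have "norm (f i j) \<le> (\<Sum>i\<in>xind G. norm (f i j))"
      by (rule member_le_sum) (use that finite_xind in auto)
    then show "norm (of_real (W j) * f i j) \<le> \<bar>W j\<bar> * (\<Sum>i\<in>xind G. norm (f i j))"
      by (simp add: norm_mult mult_left_mono)
  qed auto
  then have "(\<lambda>x. norm (case x of (i, j) \<Rightarrow> of_real (W j) * f i j)) summable_on (xind G \<times> vind G)"
    unfolding Infinite_Sum.abs_summable_on_Sigma_iff prod.case by (simp add: finite_xind)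
  then show "weighted_summable G W f"
    by (simp only: weighted_summable_def case_prod_unfold)
qed

lemma moment_alt:
  assumes "weighted_summable G W f"
  shows "moment G W f = (\<Sum>\<^sub>\<infinity>j\<in>vind G. of_real (W j) * (\<Sum>i\<in>xind G. f i j))"
proof -
  have s: "(\<lambda>(i, j). of_real (W j) * f i j) summable_on (xind G \<times> vind G)"
    using assms by (subst abs_summable_summable) (simp_all only: weighted_summable_def case_prod_unfold)
  have "moment G W f = (\<Sum>\<^sub>\<infinity>i\<in>xind G. \<Sum>\<^sub>\<infinity>j\<in>vind G. of_real (W j) * f i j)"
    unfolding moment_def by (rule infsum_Sigma'_banach[OF s, symmetric])
  also have "\<dots> = (\<Sum>\<^sub>\<infinity>j\<in>vind G. \<Sum>\<^sub>\<infinity>i\<in>xind G. of_real (W j) * f i j)"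
    by (rule infsum_swap_banach[OF s])
  finally show ?thesis
    by (simp add: finite_xind sum_distrib_left)
qed

text \<open>
  At a fixed velocity the weight is a constant factor of the spatial sum, which the step preserves
  exactly and whose absolute counterpart grows at most by a factor \<open>K\<close> common to all velocities.
\<close>

lemma directional_step_moment:
  assumes G: "valid_grid G" and f: "weighted_summable G W f"
  shows "weighted_summable G W (directional_step m G dt \<alpha> f)"
    and "moment G W (directional_step m G dt \<alpha> f) = moment G W f"
proof -
  obtain K where K: "(\<Sum>i\<in>xind G. norm (directional_step m G dt \<alpha> f i j)) \<le> K * (\<Sum>i\<in>xind G. norm (f i j))"
    for f j
    using directional_step_norm_bound[OF G] by meson
  have "(\<lambda>j. K * (\<bar>W j\<bar> * (\<Sum>i\<in>xind G. norm (f i j)))) summable_on vind G"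
    using f unfolding weighted_summable_alt by (rule summable_on_cmult_right)
  then show f': "weighted_summable G W (directional_step m G dt \<alpha> f)"
    unfolding weighted_summable_alt
  proof (rule summable_on_comparison_test)
    fix j
    show "\<bar>W j\<bar> * (\<Sum>i\<in>xind G. norm (directional_step m G dt \<alpha> f i j))
        \<le> K * (\<bar>W j\<bar> * (\<Sum>i\<in>xind G. norm (f i j)))"
      using mult_left_mono[OF K[of f j], of "\<bar>W j\<bar>"] by (simp add: mult.left_commute)
  qed (auto intro!: mult_nonneg_nonneg sum_nonneg)
  show "moment G W (directional_step m G dt \<alpha> f) = moment G W f"
    by (simp add: moment_alt[OF f'] moment_alt[OF f] directional_step_sum[OF G])
qed

lemma xv_step_moment:
  assumes "valid_grid G" and "weighted_summable G W f"
  shows "weighted_summable G W (fst (xv_step m G dt (f, B, p)))"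
    and "moment G W (fst (xv_step m G dt (f, B, p))) = moment G W f"
  using assms by (simp_all add: directional_step_moment)

text \<open>
  Needed for the weight \<open>\<bar>v\<bar>\<^sup>2\<close>, which is not a monomial but a sum of three.
\<close>

lemma weighted_summable_sum:
  assumes "finite A" "\<And>a. a \<in> A \<Longrightarrow> weighted_summable G (W a) f"
  shows "weighted_summable G (\<lambda>j. \<Sum>a\<in>A. W a j) f"
proof -
  have *: "(\<lambda>j. \<Sum>a\<in>A. \<bar>W a j\<bar> * (\<Sum>i\<in>xind G. norm (f i j))) summable_on vind G"
    using assms
  proof (induction A rule: finite_induct)
    case (insert a A)
    then show ?case
      by (simp add: summable_on_add weighted_summable_alt)
  qed simp
  show ?thesis
    unfolding weighted_summable_alt
  proof (rule summable_on_comparison_test[OF *])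
    fix j
    show "\<bar>\<Sum>a\<in>A. W a j\<bar> * (\<Sum>i\<in>xind G. norm (f i j))
        \<le> (\<Sum>a\<in>A. \<bar>W a j\<bar> * (\<Sum>i\<in>xind G. norm (f i j)))"
      unfolding sum_distrib_right[symmetric] by (intro mult_right_mono sum_abs sum_nonneg) auto
  qed (auto intro!: mult_nonneg_nonneg sum_nonneg)
qed

lemma moments_summable_iff:
  "moments_summable G (f, B, p) \<longleftrightarrow>
    (\<forall>q :: 3 \<Rightarrow> nat. (\<Sum>\<alpha>\<in>UNIV. q \<alpha>) \<le> 2 \<longrightarrow>
      weighted_summable G (\<lambda>j. \<Prod>\<alpha>\<in>UNIV. (vel G j $ \<alpha>) ^ q \<alpha>) f)"
  by (simp add: weighted_summable_def)

lemma invariants_as_moments: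
  "mass G (f, B, p) = moment G (\<lambda>_. 1) f * of_real (dx G) * of_real (dv G)"
  "momentum G \<alpha> (f, B, p) = moment G (\<lambda>j. vel G j $ \<alpha>) f * of_real (dx G) * of_real (dv G)"
  "energy G \<gamma> (f, B, p) =
     1 / 2 * (moment G (\<lambda>j. (norm (vel G j))\<^sup>2) f * of_real (dx G) * of_real (dv G))
     + of_real (1 / 2 * (\<Sum>i\<in>xind G. (norm (B i))\<^sup>2 * dx G) + 1 / (\<gamma> - 1) * (\<Sum>i\<in>xind G. p i * dx G))"
  by (simp_all only: mass.simps momentum.simps energy.simps moment_def
      infsum_cmult_left'[symmetric] case_prod_unfold mult_1_left of_real_1)

theorem theorem4p4:
  fixes G :: phase_grid and m :: translation and dt \<gamma> :: real and S :: state
  assumes "valid_grid G"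
    and "\<gamma> \<noteq> 1"
    and "moments_summable G S"
  shows "moments_summable G (xv_step m G dt S)
    \<and> mass G (xv_step m G dt S) = mass G S
    \<and> (\<forall>\<alpha>. momentum G \<alpha> (xv_step m G dt S) = momentum G \<alpha> S)
    \<and> energy G \<gamma> (xv_step m G dt S) = energy G \<gamma> S"
proof -
  obtain f B p where S: "S = (f, B, p)"
    by (cases S) auto
  define f' where "f' = fst (xv_step m G dt (f, B, p))"
  have step: "xv_step m G dt S = (f', B, p)"
    by (simp add: S f'_def)
  have conserved: "weighted_summable G W f' \<and> moment G W f' = moment G W f"
    if "weighted_summable G W f" for W
    using xv_step_moment[OF assms(1) that] by (simp add: f'_def)
  have monomial: "weighted_summable G (\<lambda>j. \<Prod>\<alpha>\<in>UNIV. (vel G j $ \<alpha>) ^ q \<alpha>) f"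
    if "(\<Sum>\<alpha>\<in>UNIV. q \<alpha>) \<le> 2" for q :: "3 \<Rightarrow> nat"
    using assms(3) that unfolding S moments_summable_iff by blast
  have power: "weighted_summable G (\<lambda>j. (vel G j $ \<alpha>) ^ n) f" if "n \<le> 2" for \<alpha> n
  proof -
    have "(\<Prod>\<beta>\<in>UNIV. (vel G j $ \<beta>) ^ (if \<beta> = \<alpha> then n else 0)) = (vel G j $ \<alpha>) ^ n" for j
    proof -
      have "(\<Prod>\<beta>\<in>UNIV. (vel G j $ \<beta>) ^ (if \<beta> = \<alpha> then n else 0)) =
          (\<Prod>\<beta>\<in>UNIV. if \<beta> = \<alpha> then (vel G j $ \<beta>) ^ n else 1)"
        by (rule prod.cong) auto
      then show ?thesis by simp
    qed
    then show ?thesis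
      using monomial[of "\<lambda>\<beta>. if \<beta> = \<alpha> then n else 0"] that by simp
  qed
  have square: "(norm (vel G j))\<^sup>2 = (\<Sum>\<alpha>\<in>UNIV. (vel G j $ \<alpha>) ^ 2)" for j
    by (simp add: norm_vec_def L2_set_def sum_nonneg)
  have "weighted_summable G (\<lambda>j. (norm (vel G j))\<^sup>2) f"
    unfolding square by (intro weighted_summable_sum power) auto
  moreover have "weighted_summable G (\<lambda>_. 1) f"
    using power[of 0] by simp
  moreover have "weighted_summable G (\<lambda>j. vel G j $ \<alpha>) f" for \<alpha>
    using power[of 1 \<alpha>] by simp
  moreover have "moments_summable G (f', B, p)"
    unfolding moments_summable_iff using conserved monomial by blast
  ultimately show ?thesis
    using conserved unfolding step unfolding S invariants_as_moments by simp
qed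

end
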